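(* Let $A\in\mathbb{R}^{m\times n}$ with $m\ll n$, let $k\ge 1$ be an integer (the sparsity level), let $\sigma_1$ and $\sigma_m$ be the largest and the smallest singular values of $A$, and suppose that the restricted isometry constant of order $3k$ of $A$ satisfies $\delta_{3k}<\frac{1}{\sqrt{3}}$. Let $y:=Ax+e$ be the measurements of the signal $x\in\mathbb{R}^n$, where $e\in\mathbb{R}^m$ is the measurement error. Let $\epsilon$ be a given parameter satisfying $$\epsilon>\max\left\{\sigma_1^2,\ \left(\frac{\sigma_1^2-\sigma_m^2}{\frac{1}{\sqrt3}-\delta_{3k}}-1\right)\sigma_1^2\right\}.$$ If the stepsize $\lambda$ in the NSIHT algorithm satisfies $$\epsilon+\sigma_1^2-\left(\frac{1}{\sqrt3}-\delta_{3k}\right)\frac{\epsilon+\sigma_1^2}{\sigma_1^2}<\lambda\le\epsilon+\sigma_m^2,$$ then the sequence $\{x^p\}$ generated by NSIHT approximates $x_S$ with error $$\|x^{p+1}-x_S\|_2\le\rho^p\|x^0-x_S\|_2+\tau\|Ax_{\overline S}+e\|_2,$$ where $$\rho=\sqrt3\left(\delta_{3k}+\sigma_1^2-\frac{\lambda\sigma_1^2}{\epsilon+\sigma_1^2}\right)<1\qquad\text{and}\qquad \tau=\frac{\sqrt3\,\lambda\sigma_1}{(\epsilon+\sigma_1^2)(1-\rho)}.$$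
   Context: A vector is $q$-sparse if it has at most $q$ nonzero entries. The singular values of $A\in\mathbb{R}^{m\times n}$ are written $\sigma_1\ge\sigma_2\ge\dots\ge\sigma_m$. Restricted isometry constant: for an integer $q$, $\delta_q$ is the smallest number $\delta_q\in(0,1]$ such that $(1-\delta_q)\|z\|_2^2\le\|Az\|_2^2\le(1+\delta_q)\|z\|_2^2$ for all $q$-sparse vectors $z\in\mathbb{R}^n$. An alternative expression is $\delta_q=\max_{T\subset\{1,\dots,n\},\,|T|\le q}\|A_T^TA_T-I\|_2$, where $A_T$ is the submatrix of columns of $A$ indexed by $T$ and $\|\cdot\|_2$ is the spectral norm. Hard thresholding operator: for $z\in\mathbb{R}^n$, $\mathcal{H}_k(z)$ is the vector obtained from $z$ by retaining the $k$ entries of largest magnitude and setting all other entries to $0$. For $x\in\mathbb{R}^n$, $x_S\in\mathbb{R}^n$ denotes the vector obtained from $x$ by retaining its $k$ largest magnitudes and zeroing out its other entries, with $S=\mathrm{supp}(\mathcal{H}_k(x))$, and $x_{\overline S}:=x-x_S\in\mathbb{R}^n$. NSIHT algorithm (Newton-step-based iterative hard thresholding): with input the measurement matrix $A$, measurement vector $y$, sparsity level $k$, parameter $\epsilon>0$ and stepsize $\lambda$, and starting from an initial point $x^0$, it iterates for $p=0,1,2,\dots$ $$x^{p+1}=\mathcal{H}_k\left(x^p+\lambda(A^TA+\epsilon I)^{-1}A^T(y-Ax^p)\right).$$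
   Formalization: The initial point x^0 is additionally assumed to be k-sparse; for an arbitrary x^0 the error bound can already fail at p=0 (for example x^0 = x_S + v with v a suitable dense vector in the kernel of A). *)

theory Defs
  imports "HOL-Analysis.Analysis"
begin

definition q_sparse :: "nat \<Rightarrow> real ^ 'n \<Rightarrow> bool" where
  "q_sparse q z \<longleftrightarrow> card {i. z $ i \<noteq> 0} \<le> q"

(* Nonnegative square roots of the eigenvalues of A A^T. For CARD('m) \<le> CARD('n) these are
   exactly the values \<sigma>_1 \<ge> ... \<ge> \<sigma>_m (taken without multiplicity, possibly including 0);
   for CARD('m) > CARD('n) the set would contain a spurious 0. *)
definition singular_values :: "real ^ 'n ^ 'm \<Rightarrow> real set" where
  "singular_values A =
     {\<sigma>. 0 \<le> \<sigma> \<and> (\<exists>u. u \<noteq> 0 \<and> (A ** transpose A) *v u = \<sigma>\<^sup>2 *\<^sub>R u)}"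

definition sigma_max :: "real ^ 'n ^ 'm \<Rightarrow> real" where
  "sigma_max A = Max (singular_values A)"

definition sigma_min :: "real ^ 'n ^ 'm \<Rightarrow> real" where
  "sigma_min A = Min (singular_values A)"

definition rip :: "real ^ 'n ^ 'm \<Rightarrow> nat \<Rightarrow> real \<Rightarrow> bool" where
  "rip A q \<delta> \<longleftrightarrow> (\<forall>z. q_sparse q z \<longrightarrow>
     (1 - \<delta>) * (norm z)\<^sup>2 \<le> (norm (A *v z))\<^sup>2 \<and>
     (norm (A *v z))\<^sup>2 \<le> (1 + \<delta>) * (norm z)\<^sup>2)"

(* A relation rather than a function: some matrices satisfy the inequalities for no value
   in (0,1], and then have no restricted isometry constant. *)
definition is_ric :: "real ^ 'n ^ 'm \<Rightarrow> nat \<Rightarrow> real \<Rightarrow> bool" where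
  "is_ric A q \<delta> \<longleftrightarrow> \<delta> \<in> {0<..1} \<and> rip A q \<delta> \<and> (\<forall>\<delta>'\<in>{0<..1}. rip A q \<delta>' \<longrightarrow> \<delta> \<le> \<delta>')"

(* The set of all admissible values of H_k(z): when magnitudes tie, the k largest entries
   are not unique, and each selection is allowed. All entries are kept if k exceeds the dimension. *)
definition hard_thresholds :: "nat \<Rightarrow> real ^ 'n \<Rightarrow> (real ^ 'n) set" where
  "hard_thresholds k z =
     {(\<chi> i. if i \<in> T then z $ i else 0) | T.
        card T = min k CARD('n) \<and> (\<forall>i\<in>T. \<forall>j. j \<notin> T \<longrightarrow> \<bar>z $ j\<bar> \<le> \<bar>z $ i\<bar>)}"

definition nsiht_step ::
    "real ^ 'n ^ 'm \<Rightarrow> real ^ 'm \<Rightarrow> real \<Rightarrow> real \<Rightarrow> real ^ 'n \<Rightarrow> real ^ 'n" where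
  "nsiht_step A y \<epsilon> lam z =
     z + lam *\<^sub>R (matrix_inv (transpose A ** A + \<epsilon> *\<^sub>R mat 1) *v (transpose A *v (y - A *v z)))"

definition nsiht_sequence ::
    "real ^ 'n ^ 'm \<Rightarrow> real ^ 'm \<Rightarrow> nat \<Rightarrow> real \<Rightarrow> real \<Rightarrow> (nat \<Rightarrow> real ^ 'n) \<Rightarrow> bool" where
  "nsiht_sequence A y k \<epsilon> lam xs \<longleftrightarrow>
     (\<forall>p. xs (Suc p) \<in> hard_thresholds k (nsiht_step A y \<epsilon> lam (xs p)))"

end

theory Submission
  imports Defs
begin

text \<open>
  Put \<open>r = A (x - xS) + e\<close>, so that \<open>y - A z = A (xS - z) + r\<close>. Before thresholding, the error
  \<open>w\<close> of the current iterate becomes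
  \<open>(w - A\<^sup>T A w) + (A\<^sup>T A w - \<lambda> (A\<^sup>T A + \<epsilon> I)\<^sup>-\<^sup>1 A\<^sup>T A w) + \<lambda> (A\<^sup>T A + \<epsilon> I)\<^sup>-\<^sup>1 A\<^sup>T r\<close>.
  Restricted to the at most \<open>3k\<close> indices that matter, the first part is at most \<open>\<delta> \<parallel>w\<parallel>\<close>. In an
  eigenbasis of \<open>A\<^sup>T A\<close> the second part multiplies by \<open>t - \<lambda> t / (\<epsilon> + t)\<close>, which for
  \<open>\<lambda> \<le> \<epsilon> + \<sigma>\<^sub>m\<^sup>2\<close> is nonnegative and increasing in \<open>t \<ge> \<sigma>\<^sub>m\<^sup>2\<close>. The third part is at most
  \<open>\<lambda> \<sigma>\<^sub>1 / (\<epsilon> + \<sigma>\<^sub>1\<^sup>2) \<parallel>r\<parallel>\<close>, because \<open>s / (\<epsilon> + s\<^sup>2)\<close> increases for \<open>s\<^sup>2 \<le> \<epsilon>\<close>. Hard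
  thresholding costs a factor \<open>\<surd>3\<close>, and the resulting affine recursion is summed.
\<close>

section \<open>The spectral theorem for self-adjoint maps\<close>

text \<open>Near \<open>s = 0\<close> the linear term dominates, so a nonzero \<open>b\<close> would
  make the expression negative on one side. This supplies the first-order condition at a maximum
  without derivatives.\<close>

lemma nonneg_quadratic_imp_linear_coeff_zero:
  fixes b c :: real
  assumes "\<And>s. 2 * s * b + s\<^sup>2 * c \<ge> 0"
  shows "b = 0"
proof (rule ccontr)
  assume b: "b \<noteq> 0"
  \<comment> \<open>Chosen so that the step \<open>- b / d\<close> is short enough:
    \<open>c < 2 * d\<close> makes the value there negative.\<close>
  define d where "d = 1 + \<bar>c\<bar>"
  have d: "d > 0" "c < 2 * d" unfolding d_def by auto
  have "2 * (- b / d) * b + (- b / d)\<^sup>2 * c = (b\<^sup>2 / d\<^sup>2) * (c - 2 * d)"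
    using d(1) by (simp add: field_simps power2_eq_square)
  moreover have "(b\<^sup>2 / d\<^sup>2) * (c - 2 * d) < 0"
    using b d by (intro mult_pos_neg) auto
  ultimately show False using assms[of "- b / d"] by linarith
qed

text \<open>A maximiser of the Rayleigh quotient on the compact unit sphere of \<open>S\<close> is
  an eigenvector, and the maximum is its eigenvalue.\<close>

lemma self_adjoint_eigenvector:
  fixes f :: "'a::euclidean_space \<Rightarrow> 'a"
  assumes f: "linear f" and sa: "\<And>x y. f x \<bullet> y = x \<bullet> f y"
    and S: "subspace S" "f ` S \<subseteq> S" and ne: "S \<noteq> {0}"
  obtains v c where "v \<in> S" "norm v = 1" "f v = c *\<^sub>R v"
proof -
  let ?K = "S \<inter> sphere 0 1"
  have "compact ?K"
    using closed_subspace[OF S(1)] by (simp add: closed_Int_compact)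
  moreover have "?K \<noteq> {}"
  proof -
    obtain x where "x \<in> S" "x \<noteq> 0" using ne subspace_0[OF S(1)] by auto
    then have "(1 / norm x) *\<^sub>R x \<in> ?K" using subspace_scale[OF S(1)] by simp
    then show ?thesis by blast
  qed
  moreover have "continuous_on ?K (\<lambda>x. f x \<bullet> x)"
    using linear_continuous_on[OF linear_conv_bounded_linear[THEN iffD1, OF f]]
    by (intro continuous_intros)
  ultimately obtain v where v: "v \<in> ?K" and vmax: "\<forall>x\<in>?K. f x \<bullet> x \<le> f v \<bullet> v"
    using continuous_attains_sup[of ?K "\<lambda>x. f x \<bullet> x"] by blast
  define c where "c = f v \<bullet> v"
  have vS: "v \<in> S" and vv: "v \<bullet> v = 1" and nv: "norm v = 1"
    using v by (auto simp: dot_square_norm)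
  have Q: "f x \<bullet> x \<le> c * (x \<bullet> x)" if "x \<in> S" for x
  proof (cases "x = 0")
    case True
    then show ?thesis by simp
  next
    case False
    then have "(1 / norm x) *\<^sub>R x \<in> ?K" using that subspace_scale[OF S(1)] by simp
    with vmax have "f ((1 / norm x) *\<^sub>R x) \<bullet> ((1 / norm x) *\<^sub>R x) \<le> c"
      unfolding c_def by blast
    then show ?thesis using False
      by (simp add: linear_scale[OF f] dot_square_norm field_simps power2_eq_square)
  qed
  \<comment> \<open>The form \<open>c * (x \<bullet> x) - f x \<bullet> x\<close> is nonnegative on
    \<open>S\<close> and vanishes at \<open>v\<close>, so its first variation at \<open>v\<close>
    along \<open>w\<close> is zero.\<close>
  have "(c *\<^sub>R v - f v) \<bullet> w = 0" if w: "w \<in> S" for w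
  proof (rule nonneg_quadratic_imp_linear_coeff_zero)
    fix s :: real
    have "v + s *\<^sub>R w \<in> S" using vS w S(1) by (simp add: subspace_add subspace_scale)
    then have "0 \<le> c * ((v + s *\<^sub>R w) \<bullet> (v + s *\<^sub>R w)) - f (v + s *\<^sub>R w) \<bullet> (v + s *\<^sub>R w)"
      using Q by simp
    also have "\<dots> = 2 * s * ((c *\<^sub>R v - f v) \<bullet> w) + s\<^sup>2 * (c * (w \<bullet> w) - f w \<bullet> w)"
      using vv sa[of w v] inner_commute[of "f w" v] inner_commute[of "f v" w]
        inner_commute[of v w] c_def
      by (simp add: linear_add[OF f] linear_scale[OF f] algebra_simps power2_eq_square)
    finally show "0 \<le> 2 * s * ((c *\<^sub>R v - f v) \<bullet> w) + s\<^sup>2 * (c * (w \<bullet> w) - f w \<bullet> w)" .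
  qed
  \<comment> \<open>By invariance this vector is itself an admissible direction \<open>w\<close>,
    hence orthogonal to itself.\<close>
  moreover have "c *\<^sub>R v - f v \<in> S"
    using vS S by (auto intro: subspace_diff subspace_scale)
  ultimately have "f v = c *\<^sub>R v" by (metis eq_iff_diff_eq_0 inner_eq_zero_iff)
  then show ?thesis using that vS nv by blast
qed

text \<open>Split off one unit eigenvector; self-adjointness keeps its orthogonal complement in
  \<open>S\<close> invariant. Invariant subspaces, not just the whole space, are treated so that
  induction on dimension applies.\<close>

lemma self_adjoint_orthonormal_eigenvectors_spanning:
  fixes f :: "'a::euclidean_space \<Rightarrow> 'a"
  assumes f: "linear f" and sa: "\<And>x y. f x \<bullet> y = x \<bullet> f y"
    and "subspace S" "f ` S \<subseteq> S"
  shows "\<exists>B. pairwise orthogonal B \<and> span B = S \<and> (\<forall>b\<in>B. norm b = 1 \<and> (\<exists>c. f b = c *\<^sub>R b))"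
  using assms(3,4)
proof (induction "dim S" arbitrary: S rule: less_induct)
  case less
  show ?case
  proof (cases "S = {0}")
    case True
    then show ?thesis by (intro exI[of _ "{}"]) auto
  next
    case False
    then obtain v c where v: "v \<in> S" "norm v = 1" "f v = c *\<^sub>R v"
      using self_adjoint_eigenvector[OF f sa less.prems] by blast
    define S' where "S' = S \<inter> {x. v \<bullet> x = 0}"
    have sub: "subspace S'"
      unfolding S'_def using less.prems(1) by (intro subspace_inter subspace_hyperplane)
    have vv: "v \<bullet> v = 1" using v(2) by (simp add: dot_square_norm)
    then have "v \<notin> S'" by (simp add: S'_def)
    with v(1) have "S' \<subset> S" unfolding S'_def by blast
    then have "dim S' < dim S"
      using sub less.prems(1) by (intro dim_psubset) (metis span_eq_iff)
    moreover have "f ` S' \<subseteq> S'"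
    proof
      fix y assume "y \<in> f ` S'"
      then obtain x where x: "x \<in> S" "v \<bullet> x = 0" "y = f x" by (auto simp: S'_def)
      have "v \<bullet> f x = c * (v \<bullet> x)" by (metis sa v(3) inner_scaleR_left)
      then show "y \<in> S'" using x less.prems(2) by (auto simp: S'_def)
    qed
    ultimately obtain B where B: "pairwise orthogonal B" "span B = S'"
        "\<forall>b\<in>B. norm b = 1 \<and> (\<exists>c. f b = c *\<^sub>R b)"
      using less.hyps[of S'] sub by blast
    have orth: "v \<bullet> b = 0" if "b \<in> B" for b
      using span_base[OF that] B(2) by (simp add: S'_def)
    have "pairwise orthogonal (insert v B)"
      using B(1) orth by (auto simp: pairwise_insert orthogonal_def inner_commute)
    moreover have "span (insert v B) = S"
    proof
      show "span (insert v B) \<subseteq> S"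
        using v(1) B(2) \<open>S' \<subset> S\<close> span_superset[of B] less.prems(1) by (intro span_minimal) auto
      show "S \<subseteq> span (insert v B)"
      proof
        fix x assume x: "x \<in> S"
        have "x - (v \<bullet> x) *\<^sub>R v \<in> S'"
          using x v(1) less.prems(1) vv
          by (auto simp: S'_def inner_diff_right intro: subspace_diff subspace_scale)
        then show "x \<in> span (insert v B)" using B(2) by (auto simp: span_breakdown_eq)
      qed
    qed
    ultimately show ?thesis using B(3) v(2,3) by (intro exI[of _ "insert v B"]) blast
  qed
qed

text \<open>Orthonormality is encoded through Parseval: applied to a member of \<open>B\<close>,
  which has norm 1, it forces all other members to be orthogonal to it. This coordinate form is what
  the norm estimates use.\<close>

definition eigenbasis :: "('a::euclidean_space \<Rightarrow> 'a) \<Rightarrow> 'a set \<Rightarrow> ('a \<Rightarrow> real) \<Rightarrow> bool" where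
  "eigenbasis f B t \<longleftrightarrow> finite B \<and> (\<forall>b\<in>B. norm b = 1 \<and> f b = t b *\<^sub>R b) \<and>
     (\<forall>x. (norm x)\<^sup>2 = (\<Sum>b\<in>B. (x \<bullet> b)\<^sup>2)) \<and> (\<forall>x. \<forall>b\<in>B. f x \<bullet> b = t b * (x \<bullet> b))"

text \<open>The remainder after subtracting the expansion is orthogonal to \<open>B\<close>, hence
  to the whole space and to itself.\<close>

lemma orthonormal_parseval:
  fixes B :: "'a::euclidean_space set"
  assumes orth: "pairwise orthogonal B" and span: "span B = UNIV" and unit: "\<And>b. b \<in> B \<Longrightarrow> norm b = 1"
    and fin: "finite B"
  shows "(norm x)\<^sup>2 = (\<Sum>b\<in>B. (x \<bullet> b)\<^sup>2)"
proof -
  define y where "y = x - (\<Sum>b\<in>B. (x \<bullet> b) *\<^sub>R b)"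
  have "orthogonal y b" if b: "b \<in> B" for b
  proof -
    have "(\<Sum>a\<in>B. (x \<bullet> a) * (a \<bullet> b)) = (\<Sum>a\<in>B. if a = b then x \<bullet> b else 0)"
      using orth unit b
      by (intro sum.cong) (auto simp: pairwise_def orthogonal_def dot_square_norm)
    then show ?thesis using b fin
      by (simp add: y_def orthogonal_def inner_diff_left inner_sum_left)
  qed
  then have "orthogonal y y" using orthogonal_to_span[of y B y] span by simp
  then have "x = (\<Sum>b\<in>B. (x \<bullet> b) *\<^sub>R b)" by (simp add: y_def orthogonal_self)
  then have "x \<bullet> x = x \<bullet> (\<Sum>b\<in>B. (x \<bullet> b) *\<^sub>R b)" by simp
  then show ?thesis unfolding power2_norm_eq_inner by (simp add: inner_sum_right power2_eq_square)
qed

theorem self_adjoint_eigenbasis: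
  fixes f :: "'a::euclidean_space \<Rightarrow> 'a"
  assumes f: "linear f" and sa: "\<And>x y. f x \<bullet> y = x \<bullet> f y"
  obtains B t where "eigenbasis f B t"
proof -
  obtain B where B: "pairwise orthogonal B" "span B = UNIV"
      "\<forall>b\<in>B. norm b = 1 \<and> (\<exists>c. f b = c *\<^sub>R b)"
    using self_adjoint_orthonormal_eigenvectors_spanning[OF f sa, of UNIV] by auto
  obtain t where t: "\<And>b. b \<in> B \<Longrightarrow> f b = t b *\<^sub>R b" using B(3) by metis
  have "0 \<notin> B" using B(3) by fastforce
  then have fin: "finite B"
    using pairwise_orthogonal_independent[OF B(1)] independent_imp_finite by blast
  then have "eigenbasis f B t"
    using B t sa orthonormal_parseval[OF B(1,2)] by (simp add: eigenbasis_def)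
  then show ?thesis using that by blast
qed

text \<open>Reduces operator norm bounds to scalar inequalities, one for each eigenvalue.\<close>

lemma eigenbasis_norm_le:
  assumes B: "eigenbasis f B t" and c: "c \<ge> 0"
    and le: "\<And>b. b \<in> B \<Longrightarrow> \<bar>r \<bullet> b\<bar> \<le> c * \<bar>w \<bullet> b\<bar>"
  shows "norm r \<le> c * norm w"
proof -
  have "(norm r)\<^sup>2 = (\<Sum>b\<in>B. (r \<bullet> b)\<^sup>2)" using B by (simp add: eigenbasis_def)
  also have "\<dots> \<le> (\<Sum>b\<in>B. c\<^sup>2 * (w \<bullet> b)\<^sup>2)"
  proof (rule sum_mono)
    fix b assume "b \<in> B"
    then have "\<bar>r \<bullet> b\<bar>\<^sup>2 \<le> (c * \<bar>w \<bullet> b\<bar>)\<^sup>2" using le by (intro power_mono) auto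
    then show "(r \<bullet> b)\<^sup>2 \<le> c\<^sup>2 * (w \<bullet> b)\<^sup>2" by (simp add: power_mult_distrib)
  qed
  also have "\<dots> = (c * norm w)\<^sup>2"
    using B by (simp add: eigenbasis_def power_mult_distrib sum_distrib_left)
  finally show ?thesis by (rule power2_le_imp_le) (use c in simp)
qed

lemma eigenbasis_eigenvalue_mem:
  assumes B: "eigenbasis f B t" and u: "u \<noteq> 0" "f u = c *\<^sub>R u"
  shows "c \<in> t ` B"
proof -
  have "(\<Sum>b\<in>B. (u \<bullet> b)\<^sup>2) \<noteq> 0" using B u(1) by (metis eigenbasis_def norm_eq_zero power_eq_0_iff)
  then obtain b where b: "b \<in> B" "u \<bullet> b \<noteq> 0" by (rule sum.not_neutral_contains_not_neutral) auto
  then have "c * (u \<bullet> b) = t b * (u \<bullet> b)" using B u(2) by (metis eigenbasis_def inner_scaleR_left)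
  then show ?thesis using b by auto
qed

section \<open>Singular values\<close>

lemma transpose_inner:
  fixes A :: "real ^ 'n ^ 'm"
  shows "(transpose A *v u) \<bullet> z = u \<bullet> (A *v z)"
  by (simp add: dot_lmul_matrix)

lemma linear_gram: "linear (\<lambda>z. transpose A *v ((A :: real ^ 'n ^ 'm) *v z))"
  by (simp add: matrix_vector_mul_assoc del: transpose_matrix_vector)

lemma gram_self_adjoint:
  fixes A :: "real ^ 'n ^ 'm"
  shows "(transpose A *v (A *v z)) \<bullet> w = z \<bullet> (transpose A *v (A *v w))"
  by (metis inner_commute transpose_inner)

lemma gram_eigenbasis:
  fixes A :: "real ^ 'n ^ 'm"
  obtains B t where "eigenbasis (\<lambda>z. transpose A *v (A *v z)) B t"
  using self_adjoint_eigenbasis[OF linear_gram gram_self_adjoint] by blast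

lemma gram_eigenvalue:
  fixes A :: "real ^ 'n ^ 'm"
  assumes B: "eigenbasis (\<lambda>z. transpose A *v (A *v z)) B t" and b: "b \<in> B"
  shows "t b = (norm (A *v b))\<^sup>2"
proof -
  have "t b = (transpose A *v (A *v b)) \<bullet> b"
    using B b by (simp add: eigenbasis_def dot_square_norm del: transpose_matrix_vector)
  then show ?thesis by (simp add: transpose_inner power2_norm_eq_inner del: transpose_matrix_vector)
qed

lemma gram_transpose_eigenbasis:
  fixes A :: "real ^ 'n ^ 'm"
  obtains B t where "eigenbasis (\<lambda>u. A *v (transpose A *v u)) B t"
  using gram_eigenbasis[of "transpose A"] unfolding transpose_transpose by blast

lemma gram_transpose_eigenvalue:
  fixes A :: "real ^ 'n ^ 'm"
  assumes "eigenbasis (\<lambda>u. A *v (transpose A *v u)) B t" "b \<in> B"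
  shows "t b = (norm (transpose A *v b))\<^sup>2"
  using gram_eigenvalue[of "transpose A"] assms unfolding transpose_transpose by blast

lemma singular_values_alt:
  fixes A :: "real ^ 'n ^ 'm"
  shows "singular_values A =
    {\<sigma>. 0 \<le> \<sigma> \<and> (\<exists>u. u \<noteq> 0 \<and> A *v (transpose A *v u) = \<sigma>\<^sup>2 *\<^sub>R u)}"
  by (simp add: singular_values_def matrix_vector_mul_assoc del: transpose_matrix_vector)

text \<open>Together with nonemptiness this gives \<open>Max\<close> and \<open>Min\<close> in
  \<open>sigma_max\<close> and \<open>sigma_min\<close> their meaning. Every singular value is the
  root of an eigenvalue from one fixed finite eigenbasis.\<close>

lemma finite_singular_values:
  fixes A :: "real ^ 'n ^ 'm"
  shows "finite (singular_values A)"
proof -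
  obtain B t where B: "eigenbasis (\<lambda>u. A *v (transpose A *v u)) B t"
    by (rule gram_transpose_eigenbasis)
  have "singular_values A \<subseteq> (\<lambda>b. sqrt (t b)) ` B"
  proof
    fix s assume "s \<in> singular_values A"
    then obtain u where s: "0 \<le> s" "u \<noteq> 0" "A *v (transpose A *v u) = s\<^sup>2 *\<^sub>R u"
      by (auto simp: singular_values_alt)
    then obtain b where "b \<in> B" "s\<^sup>2 = t b" using eigenbasis_eigenvalue_mem[OF B] by blast
    then show "s \<in> (\<lambda>b. sqrt (t b)) ` B" using s(1) by (metis image_eqI real_sqrt_unique)
  qed
  then show ?thesis using B finite_subset by (auto simp: eigenbasis_def)
qed

lemma gram_transpose_singular_value:
  fixes A :: "real ^ 'n ^ 'm"
  assumes B: "eigenbasis (\<lambda>u. A *v (transpose A *v u)) B t" and b: "b \<in> B"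
  shows "norm (transpose A *v b) \<in> singular_values A"
proof -
  have "b \<noteq> 0" "A *v (transpose A *v b) = (norm (transpose A *v b))\<^sup>2 *\<^sub>R b"
    using B b gram_transpose_eigenvalue[OF B b] by (auto simp: eigenbasis_def)
  then show ?thesis unfolding singular_values_alt by auto
qed

text \<open>\<open>A\<close> carries an eigenvector of A^T A to one of A A^T with the same
  eigenvalue, provided the image is nonzero. Kernel vectors are excluded because their eigenvalue 0
  need not be a singular value when \<open>A\<close> has more columns than rows.\<close>

lemma gram_singular_value:
  fixes A :: "real ^ 'n ^ 'm"
  assumes B: "eigenbasis (\<lambda>z. transpose A *v (A *v z)) B t" and b: "b \<in> B" and nz: "A *v b \<noteq> 0"
  shows "norm (A *v b) \<in> singular_values A"
proof -
  have "transpose A *v (A *v b) = (norm (A *v b))\<^sup>2 *\<^sub>R b"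
    using B b gram_eigenvalue[OF B b] by (simp add: eigenbasis_def)
  then have "A *v (transpose A *v (A *v b)) = (norm (A *v b))\<^sup>2 *\<^sub>R (A *v b)"
    by (simp add: matrix_vector_mult_scaleR del: transpose_matrix_vector)
  then show ?thesis unfolding singular_values_alt using nz by auto
qed

lemma singular_values_nonempty: "singular_values (A :: real ^ 'n ^ 'm) \<noteq> {}"
proof -
  obtain B t where B: "eigenbasis (\<lambda>u. A *v (transpose A *v u)) B t"
    by (rule gram_transpose_eigenbasis)
  have "(norm (1 :: real ^ 'm))\<^sup>2 = (\<Sum>b\<in>B. (1 \<bullet> b)\<^sup>2)"
    using B unfolding eigenbasis_def by blast
  moreover have "norm (1 :: real ^ 'm) \<noteq> 0" by (simp add: vec_eq_iff)
  ultimately have "B \<noteq> {}" by (metis power_eq_0_iff sum.empty)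
  then show ?thesis using gram_transpose_singular_value[OF B] by blast
qed

lemma singular_value_bounds:
  assumes "s \<in> singular_values A"
  shows "sigma_min A \<le> s" "s \<le> sigma_max A"
  using assms finite_singular_values[of A] by (auto simp: sigma_min_def sigma_max_def)

lemma sigma_min_nonneg: "0 \<le> sigma_min A"
  using Min_in[OF finite_singular_values singular_values_nonempty, of A]
  by (auto simp: sigma_min_def singular_values_def)

lemma sigma_min_le_sigma_max: "sigma_min A \<le> sigma_max A"
  using singular_value_bounds[of _ A] singular_values_nonempty[of A] by fastforce

lemma sigma_max_nonneg: "0 \<le> sigma_max A"
  using sigma_min_nonneg sigma_min_le_sigma_max order_trans by blast

lemma norm_matrix_vector_le_sigma_max:
  fixes A :: "real ^ 'n ^ 'm"
  shows "norm (A *v z) \<le> sigma_max A * norm z"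
proof -
  obtain B t where B: "eigenbasis (\<lambda>z. transpose A *v (A *v z)) B t"
    by (rule gram_eigenbasis)
  have "norm (transpose A *v (A *v z)) \<le> (sigma_max A)\<^sup>2 * norm z"
  proof (rule eigenbasis_norm_le[OF B])
    fix b assume b: "b \<in> B"
    have "norm (A *v b) \<le> sigma_max A"
      using gram_singular_value[OF B b] singular_value_bounds(2) sigma_max_nonneg[of A]
      by (cases "A *v b = 0") auto
    then have "t b \<le> (sigma_max A)\<^sup>2" "0 \<le> t b"
      using gram_eigenvalue[OF B b] by (auto intro: power_mono)
    moreover have "(transpose A *v (A *v z)) \<bullet> b = t b * (z \<bullet> b)"
      using B b unfolding eigenbasis_def by blast
    ultimately show "\<bar>(transpose A *v (A *v z)) \<bullet> b\<bar> \<le> (sigma_max A)\<^sup>2 * \<bar>z \<bullet> b\<bar>"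
      by (simp add: abs_mult mult_right_mono del: transpose_matrix_vector)
  qed simp
  then have "(transpose A *v (A *v z)) \<bullet> z \<le> (sigma_max A)\<^sup>2 * norm z * norm z"
    using norm_cauchy_schwarz order_trans mult_right_mono norm_ge_zero by metis
  then have "(norm (A *v z))\<^sup>2 \<le> (sigma_max A * norm z)\<^sup>2"
    by (simp add: transpose_inner power2_norm_eq_inner[symmetric] power_mult_distrib
        power2_eq_square mult_ac del: transpose_matrix_vector)
  then show ?thesis by (rule power2_le_imp_le) (use sigma_max_nonneg[of A] in simp)
qed

section \<open>The regularised Newton step\<close>

text \<open>Pairing the matrix with \<open>z\<close> gives |Az|^2 + \<epsilon> |z|^2, so it is
  injective and thus invertible. The later bounds refer to the inverse only through this
  equation.\<close>

lemma regularised_gram_inverse: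
  fixes A :: "real ^ 'n ^ 'm" and g :: "real ^ 'n"
  assumes eps: "\<epsilon> > 0"
  defines "h \<equiv> matrix_inv (transpose A ** A + \<epsilon> *\<^sub>R mat 1) *v g"
  shows "transpose A *v (A *v h) + \<epsilon> *\<^sub>R h = g"
proof -
  let ?M = "transpose A ** A + \<epsilon> *\<^sub>R mat 1"
  have M: "?M *v z = transpose A *v (A *v z) + \<epsilon> *\<^sub>R z" for z
    by (simp add: matrix_vector_mult_add_rdistrib scaleR_matrix_vector_assoc[symmetric]
        matrix_vector_mul_assoc del: transpose_matrix_vector)
  have "z = 0" if "?M *v z = 0" for z
  proof -
    have "0 = (transpose A *v (A *v z) + \<epsilon> *\<^sub>R z) \<bullet> z" using that M by simp
    also have "\<dots> = (norm (A *v z))\<^sup>2 + \<epsilon> * (norm z)\<^sup>2"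
      by (simp add: inner_add_left transpose_inner power2_norm_eq_inner del: transpose_matrix_vector)
    finally show ?thesis using eps
      by (smt (verit) mult_pos_pos zero_le_power2 zero_less_norm_iff zero_less_power)
  qed
  then have "inj ((*v) ?M)"
    by (metis (no_types, lifting) eq_iff_diff_eq_0 injI matrix_vector_mult_diff_distrib)
  then have "invertible ?M"
    by (simp add: invertible_left_inverse matrix_left_invertible_injective)
  then have "?M ** matrix_inv ?M = mat 1"
    unfolding invertible_def matrix_inv_def by (rule someI2_ex) simp
  then have "?M *v h = g"
    by (simp add: h_def matrix_vector_mul_assoc)
  then show ?thesis using M by simp
qed

lemma regularised_residual_bound:
  fixes A :: "real ^ 'n ^ 'm"
  assumes eps: "\<epsilon> > 0" and lam: "lam \<le> \<epsilon> + (sigma_min A)\<^sup>2"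
    and d: "transpose A *v (A *v d) + \<epsilon> *\<^sub>R d = transpose A *v (A *v w)"
  defines "M \<equiv> (sigma_max A)\<^sup>2"
  shows "norm (transpose A *v (A *v w) - lam *\<^sub>R d) \<le> (M - lam * M / (\<epsilon> + M)) * norm w"
proof -
  let ?g = "\<lambda>s. s - lam * s / (\<epsilon> + s)"
  have smM: "(sigma_min A)\<^sup>2 \<le> M"
    unfolding M_def using sigma_min_nonneg sigma_min_le_sigma_max by (intro power_mono)
  have g_nonneg: "0 \<le> ?g s" if "(sigma_min A)\<^sup>2 \<le> s" for s
  proof -
    have s0: "0 \<le> s" using that by (meson order_trans zero_le_power2)
    then have "lam * s \<le> (\<epsilon> + s) * s" using lam that by (intro mult_right_mono) auto
    then show ?thesis using eps s0 by (simp add: field_simps)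
  qed
  have g_mono: "?g s \<le> ?g M" if s: "(sigma_min A)\<^sup>2 \<le> s" "s \<le> M" for s
  proof -
    have s0: "0 \<le> s" using s(1) by (meson order_trans zero_le_power2)
    \<comment> \<open>Follows from M/(\<epsilon>+M) - s/(\<epsilon>+s) =
      \<epsilon>(M-s)/((\<epsilon>+s)(\<epsilon>+M)); monotonicity is thereby reduced to the sign of
      one factor.\<close>
    have "?g M - ?g s = (M - s) * ((\<epsilon> + s) * (\<epsilon> + M) - lam * \<epsilon>) / ((\<epsilon> + s) * (\<epsilon> + M))"
      using eps s0 s(2) by (simp add: divide_simps) (simp add: algebra_simps)
    moreover have "lam * \<epsilon> \<le> (\<epsilon> + s) * (\<epsilon> + M)"
    proof -
      have "lam * \<epsilon> \<le> (\<epsilon> + s) * \<epsilon>" using lam s(1) eps by (intro mult_right_mono) auto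
      also have "\<dots> \<le> (\<epsilon> + s) * (\<epsilon> + M)" using eps s s0 by (intro mult_left_mono) auto
      finally show ?thesis .
    qed
    ultimately show ?thesis using eps s0 s(2)
      by (smt (verit) divide_nonneg_nonneg mult_nonneg_nonneg)
  qed
  obtain B t where B: "eigenbasis (\<lambda>z. transpose A *v (A *v z)) B t"
    by (rule gram_eigenbasis)
  show ?thesis
  proof (rule eigenbasis_norm_le[OF B])
    show gM: "0 \<le> ?g M" using g_nonneg smM by blast
    fix b assume b: "b \<in> B"
    have coeff: "(transpose A *v (A *v z)) \<bullet> b = t b * (z \<bullet> b)" for z
      using B b unfolding eigenbasis_def by blast
    have t0: "0 \<le> t b" using gram_eigenvalue[OF B b] by simp
    have "(t b + \<epsilon>) * (d \<bullet> b) = t b * (w \<bullet> b)"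
      using arg_cong[OF d, of "\<lambda>v. v \<bullet> b"]
      by (simp add: inner_add_left coeff algebra_simps del: transpose_matrix_vector)
    then have "d \<bullet> b = t b * (w \<bullet> b) / (\<epsilon> + t b)" using eps t0 by (simp add: field_simps)
    then have "(transpose A *v (A *v w) - lam *\<^sub>R d) \<bullet> b = ?g (t b) * (w \<bullet> b)"
      by (simp add: inner_diff_left coeff algebra_simps del: transpose_matrix_vector)
    moreover have "\<bar>?g (t b)\<bar> \<le> ?g M"
    proof (cases "A *v b = 0")
      \<comment> \<open>On the kernel the eigenvalue 0 may lie below the range where
        \<open>?g\<close> was shown nonnegative and monotone, but \<open>?g\<close> vanishes at
        0.\<close>
      case True
      then have "t b = 0" using gram_eigenvalue[OF B b] by simp
      then show ?thesis using gM by simp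
    next
      case False
      note sv = singular_value_bounds[OF gram_singular_value[OF B b False]]
      have "(sigma_min A)\<^sup>2 \<le> t b" "t b \<le> M"
        unfolding gram_eigenvalue[OF B b] M_def
        using sv sigma_min_nonneg[of A] by (auto intro: power_mono)
      then show ?thesis using g_nonneg[of "t b"] g_mono[of "t b"] by linarith
    qed
    ultimately show "\<bar>(transpose A *v (A *v w) - lam *\<^sub>R d) \<bullet> b\<bar> \<le> ?g M * \<bar>w \<bullet> b\<bar>"
      by (simp add: abs_mult mult_right_mono del: transpose_matrix_vector)
  qed
qed

text \<open>In an eigenbasis of A A^T, whose eigenvalues are the squared singular values u^2,
  passing from \<open>r\<close> to \<open>h\<close> costs the factor u/(\<epsilon>+u^2) in each
  coordinate.\<close>

lemma regularised_pseudoinverse_bound: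
  fixes A :: "real ^ 'n ^ 'm"
  assumes eps: "\<epsilon> > 0" "(sigma_max A)\<^sup>2 \<le> \<epsilon>"
    and h: "transpose A *v (A *v h) + \<epsilon> *\<^sub>R h = transpose A *v r"
  shows "norm h \<le> sigma_max A / (\<epsilon> + (sigma_max A)\<^sup>2) * norm r"
proof -
  define s where "s = sigma_max A"
  have s0: "0 \<le> s" using sigma_max_nonneg s_def by simp
  \<comment> \<open>This dual vector satisfies \<open>h = A\<^sup>T q\<close> and \<open>(A A\<^sup>T + \<epsilon> I) q = r\<close>.\<close>
  define q where "q = (1 / \<epsilon>) *\<^sub>R (r - A *v h)"
  have "transpose A *v q = (1 / \<epsilon>) *\<^sub>R (transpose A *v r - transpose A *v (A *v h))"
    by (simp add: q_def matrix_vector_mult_scaleR matrix_vector_mult_diff_distrib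
        del: transpose_matrix_vector)
  also have "\<dots> = (1 / \<epsilon>) *\<^sub>R (\<epsilon> *\<^sub>R h)"
    unfolding h[symmetric] by simp
  finally have hq: "transpose A *v q = h" using eps by simp
  then have q: "A *v (transpose A *v q) + \<epsilon> *\<^sub>R q = r" using eps by (simp add: q_def)
  obtain B t where B: "eigenbasis (\<lambda>u. A *v (transpose A *v u)) B t"
    by (rule gram_transpose_eigenbasis)
  have parseval: "(norm z)\<^sup>2 = (\<Sum>b\<in>B. (z \<bullet> b)\<^sup>2)" for z
    using B unfolding eigenbasis_def by blast
  have coeff: "(A *v (transpose A *v z)) \<bullet> b = t b * (z \<bullet> b)" if "b \<in> B" for z b
    using B that unfolding eigenbasis_def by blast
  let ?c = "s / (\<epsilon> + s\<^sup>2)"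
  have "t b * (q \<bullet> b)\<^sup>2 \<le> ?c\<^sup>2 * (r \<bullet> b)\<^sup>2" if b: "b \<in> B" for b
  proof -
    define u where "u = norm (transpose A *v b)"
    have tb: "t b = u\<^sup>2" using gram_transpose_eigenvalue[OF B b] u_def by simp
    have u: "0 \<le> u" "u \<le> s"
      using singular_value_bounds(2)[OF gram_transpose_singular_value[OF B b]]
      by (auto simp: u_def s_def)
    have "u * s \<le> s * s" using u by (intro mult_right_mono) auto
    then have "u * s \<le> \<epsilon>" using eps(2) by (simp add: s_def power2_eq_square)
    \<comment> \<open>This product is the cross-multiplied difference of s/(\<epsilon>+s^2) and
      u/(\<epsilon>+u^2).\<close>
    then have "0 \<le> (s - u) * (\<epsilon> - u * s)" using u by simp
    then have "u * (\<epsilon> + s\<^sup>2) \<le> s * (\<epsilon> + u\<^sup>2)" by (simp add: algebra_simps power2_eq_square)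
    moreover have pos: "0 < \<epsilon> + s\<^sup>2" "0 < \<epsilon> + u\<^sup>2" using eps by (auto intro: add_pos_nonneg)
    ultimately have "u \<le> ?c * (\<epsilon> + u\<^sup>2)"
      by (simp add: pos_le_divide_eq)
    then have "u * \<bar>q \<bullet> b\<bar> \<le> ?c * (\<epsilon> + u\<^sup>2) * \<bar>q \<bullet> b\<bar>" by (rule mult_right_mono) simp
    also have "\<dots> = ?c * \<bar>(\<epsilon> + u\<^sup>2) * (q \<bullet> b)\<bar>" using pos by (simp add: abs_mult)
    also have "(\<epsilon> + u\<^sup>2) * (q \<bullet> b) = r \<bullet> b"
      using arg_cong[OF q, of "\<lambda>v. v \<bullet> b"] coeff[OF b, of q]
      by (simp add: inner_add_left tb algebra_simps del: transpose_matrix_vector)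
    finally have "(u * \<bar>q \<bullet> b\<bar>)\<^sup>2 \<le> (?c * \<bar>r \<bullet> b\<bar>)\<^sup>2"
      using u by (intro power_mono) auto
    then show ?thesis by (simp only: tb power_mult_distrib power2_abs)
  qed
  then have "(\<Sum>b\<in>B. t b * (q \<bullet> b)\<^sup>2) \<le> (\<Sum>b\<in>B. ?c\<^sup>2 * (r \<bullet> b)\<^sup>2)" by (rule sum_mono)
  moreover have "(norm h)\<^sup>2 = (\<Sum>b\<in>B. t b * (q \<bullet> b)\<^sup>2)"
  proof -
    let ?z = "A *v (transpose A *v q)"
    have "(norm h)\<^sup>2 = q \<bullet> ?z"
      by (simp add: hq[symmetric] power2_norm_eq_inner transpose_inner del: transpose_matrix_vector)
    \<comment> \<open>Polarisation, since the eigenbasis only records Parseval for squared norms.\<close>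
    also have "\<dots> = ((norm (q + ?z))\<^sup>2 - (norm (q - ?z))\<^sup>2) / 4"
      by (simp add: power2_norm_eq_inner inner_add_left inner_add_right inner_diff_left
          inner_diff_right inner_commute del: transpose_matrix_vector)
    also have "\<dots> = (\<Sum>b\<in>B. t b * (q \<bullet> b)\<^sup>2)"
      unfolding parseval sum_subtractf[symmetric] sum_divide_distrib
      by (intro sum.cong) (auto simp: inner_add_left inner_diff_left coeff power2_eq_square
          algebra_simps simp del: transpose_matrix_vector)
    finally show ?thesis .
  qed
  ultimately have "(norm h)\<^sup>2 \<le> (?c * norm r)\<^sup>2"
    by (simp only: parseval[of r] power_mult_distrib sum_distrib_left)
  then show ?thesis
    unfolding s_def by (rule power2_le_imp_le) (use s0 eps in \<open>simp add: s_def\<close>)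
qed

section \<open>Restricted isometry and hard thresholding\<close>

definition restrict_vec :: "'n set \<Rightarrow> real ^ 'n \<Rightarrow> real ^ 'n" where
  "restrict_vec V z = (\<chi> i. if i \<in> V then z $ i else 0)"

lemma restrict_vec_component: "restrict_vec V z $ i = (if i \<in> V then z $ i else 0)"
  by (simp add: restrict_vec_def)

lemma norm_restrict_vec_squared: "(norm (restrict_vec V z))\<^sup>2 = (\<Sum>i\<in>V. (z $ i)\<^sup>2)"
  unfolding power2_norm_eq_inner inner_vec_def restrict_vec_component
  by (rule sum.mono_neutral_cong_right) (auto simp: power2_eq_square)

lemma norm_restrict_vec_le: "norm (restrict_vec V z) \<le> norm z"
  by (rule norm_le_componentwise_cart) (simp add: restrict_vec_component)

lemma restrict_vec_add: "restrict_vec V (z + w) = restrict_vec V z + restrict_vec V w"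
  by (simp add: vec_eq_iff restrict_vec_component)

lemma q_sparse_supported:
  assumes "card V \<le> q" "\<And>i. i \<notin> V \<Longrightarrow> z $ i = 0"
  shows "q_sparse q z"
proof -
  have "card {i. z $ i \<noteq> 0} \<le> card V" using assms(2) by (intro card_mono) auto
  then show ?thesis using assms(1) by (simp add: q_sparse_def)
qed

text \<open>Polarisation: the lower isometry bound is applied to the sum and the upper one to the
  difference, both still supported in \<open>V\<close>. Scaling to unit vectors then turns the mean
  of the squared norms into their product.\<close>

lemma rip_inner:
  fixes A :: "real ^ 'n ^ 'm"
  assumes rip: "rip A q \<delta>" and V: "card V \<le> q"
    and z: "\<And>i. i \<notin> V \<Longrightarrow> z $ i = 0" and w: "\<And>i. i \<notin> V \<Longrightarrow> w $ i = 0"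
  shows "z \<bullet> w - (A *v z) \<bullet> (A *v w) \<le> \<delta> * norm z * norm w"
proof (cases "z = 0 \<or> w = 0")
  case True
  then show ?thesis by auto
next
  case False
  have sq: "z' \<bullet> w' - (A *v z') \<bullet> (A *v w') \<le> \<delta> * ((norm z')\<^sup>2 + (norm w')\<^sup>2) / 2"
    if "\<And>i. i \<notin> V \<Longrightarrow> z' $ i = 0" "\<And>i. i \<notin> V \<Longrightarrow> w' $ i = 0" for z' w'
  proof -
    have "q_sparse q (z' + w')" "q_sparse q (z' - w')"
      using that by (auto intro: q_sparse_supported[OF V])
    then have "(1 - \<delta>) * (norm (z' + w'))\<^sup>2 \<le> (norm (A *v (z' + w')))\<^sup>2"
      "(norm (A *v (z' - w')))\<^sup>2 \<le> (1 + \<delta>) * (norm (z' - w'))\<^sup>2"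
      using rip by (auto simp: rip_def)
    then show ?thesis
      unfolding matrix_vector_right_distrib matrix_vector_mult_diff_distrib power2_norm_eq_inner
        inner_add_left inner_add_right inner_diff_left inner_diff_right
      by (simp add: algebra_simps inner_commute)
  qed
  let ?z = "(1 / norm z) *\<^sub>R z" and ?w = "(1 / norm w) *\<^sub>R w"
  have unit: "norm ?z = 1" "norm ?w = 1" using False by auto
  have "?z \<bullet> ?w - (A *v ?z) \<bullet> (A *v ?w) \<le> \<delta> * ((norm ?z)\<^sup>2 + (norm ?w)\<^sup>2) / 2"
    using z w by (intro sq) auto
  also have "\<dots> = \<delta>" unfolding unit by simp
  finally have "?z \<bullet> ?w - (A *v ?z) \<bullet> (A *v ?w) \<le> \<delta>" .
  then have "(z \<bullet> w - (A *v z) \<bullet> (A *v w)) / (norm z * norm w) \<le> \<delta>"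
    by (simp add: matrix_vector_mult_scaleR diff_divide_distrib mult.commute)
  then show ?thesis using False by (simp add: pos_divide_le_eq mult.assoc)
qed

text \<open>Testing the vector against its own restriction, which is supported in \<open>V\<close>
  like \<open>w\<close>, brings it within reach of \<open>rip_inner\<close>. The restriction is
  essential because A^T A w may spread over all indices.\<close>

lemma rip_restrict_bound:
  fixes A :: "real ^ 'n ^ 'm"
  assumes rip: "rip A q \<delta>" and V: "card V \<le> q"
    and w: "\<And>i. i \<notin> V \<Longrightarrow> w $ i = 0" and d: "0 \<le> \<delta>"
  shows "norm (restrict_vec V (w - transpose A *v (A *v w))) \<le> \<delta> * norm w"
proof -
  let ?v = "w - transpose A *v (A *v w)"
  let ?z = "restrict_vec V ?v"
  have "(norm ?z)\<^sup>2 = ?v \<bullet> ?z"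
    unfolding power2_norm_eq_inner inner_vec_def
    by (intro sum.cong) (auto simp: restrict_vec_component simp del: transpose_matrix_vector)
  also have "\<dots> = ?z \<bullet> w - (A *v ?z) \<bullet> (A *v w)"
    unfolding inner_diff_left transpose_inner by (simp only: inner_commute)
  also have "\<dots> \<le> \<delta> * norm ?z * norm w"
    by (rule rip_inner[OF rip V _ w]) (simp add: restrict_vec_component)
  finally have "norm ?z * norm ?z \<le> norm ?z * (\<delta> * norm w)"
    by (simp only: power2_eq_square mult_ac)
  then show ?thesis
    using d by (cases "norm ?z = 0") (auto simp del: transpose_matrix_vector)
qed

text \<open>Equal cardinalities allow each index lost from \<open>S\<close> to be matched with a
  selected index of at least the same magnitude.\<close>

lemma sum_squares_exchange:
  fixes u :: "real ^ 'n"
  assumes card: "card S = card T" and top: "\<forall>i\<in>T. \<forall>j. j \<notin> T \<longrightarrow> \<bar>u $ j\<bar> \<le> \<bar>u $ i\<bar>"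
  shows "(\<Sum>i\<in>S - T. (u $ i)\<^sup>2) \<le> (\<Sum>i\<in>T - S. (u $ i)\<^sup>2)"
proof -
  have "card (S - T) = card (T - S)"
    using card by (simp add: card_Diff_subset_Int Int_commute)
  then obtain f where f: "bij_betw f (S - T) (T - S)"
    by (metis finite finite_same_card_bij)
  have "(\<Sum>i\<in>S - T. (u $ i)\<^sup>2) \<le> (\<Sum>i\<in>S - T. (u $ f i)\<^sup>2)"
  proof (rule sum_mono)
    fix i assume i: "i \<in> S - T"
    then have "f i \<in> T" using f by (auto dest: bij_betwE)
    then show "(u $ i)\<^sup>2 \<le> (u $ f i)\<^sup>2" using top i abs_le_square_iff by blast
  qed
  also have "\<dots> = (\<Sum>i\<in>T - S. (u $ i)\<^sup>2)"
    using sum.reindex_bij_betw[OF f, of "\<lambda>i. (u $ i)\<^sup>2"] .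
  finally show ?thesis .
qed

text \<open>On \<open>S - T\<close> the error is \<open>v\<close>, whose square is at most twice
  that of \<open>u - v\<close> plus twice that of \<open>u\<close>. The latter is exchanged for
  entries on \<open>T - S\<close>, where \<open>v\<close> vanishes. Thus \<open>S - T\<close> is
  counted twice and \<open>T\<close> at most three times.\<close>

lemma hard_threshold_error:
  fixes u v :: "real ^ 'n"
  assumes card: "card S = card T" and top: "\<forall>i\<in>T. \<forall>j. j \<notin> T \<longrightarrow> \<bar>u $ j\<bar> \<le> \<bar>u $ i\<bar>"
    and v: "\<And>i. i \<notin> S \<Longrightarrow> v $ i = 0" and V: "S \<union> T \<subseteq> V"
  shows "norm (restrict_vec T u - v) \<le> sqrt 3 * norm (restrict_vec V (u - v))"
proof -
  let ?e = "\<lambda>i. (u $ i - v $ i)\<^sup>2"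
  have "restrict_vec T u - v = restrict_vec (S \<union> T) (restrict_vec T u - v)"
    using v by (auto simp: vec_eq_iff restrict_vec_component)
  then have "(norm (restrict_vec T u - v))\<^sup>2 = (\<Sum>i\<in>S \<union> T. ((restrict_vec T u - v) $ i)\<^sup>2)"
    by (metis norm_restrict_vec_squared)
  also have "\<dots> = (\<Sum>i\<in>S - T. (v $ i)\<^sup>2) + (\<Sum>i\<in>T. ?e i)"
  proof -
    have "S \<union> T = (S - T) \<union> T" by blast
    then have "(\<Sum>i\<in>S \<union> T. ((restrict_vec T u - v) $ i)\<^sup>2) =
        (\<Sum>i\<in>S - T. ((restrict_vec T u - v) $ i)\<^sup>2) + (\<Sum>i\<in>T. ((restrict_vec T u - v) $ i)\<^sup>2)"
      by (metis (no_types, lifting) Diff_disjoint Int_commute finite sum.union_disjoint)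
    then show ?thesis by (simp add: restrict_vec_component)
  qed
  also have "\<dots> \<le> 3 * (\<Sum>i\<in>S \<union> T. ?e i)"
  proof -
    have "(\<Sum>i\<in>S - T. (v $ i)\<^sup>2) \<le> (\<Sum>i\<in>S - T. 2 * ?e i + 2 * (u $ i)\<^sup>2)"
    proof (rule sum_mono)
      fix i
      show "(v $ i)\<^sup>2 \<le> 2 * ?e i + 2 * (u $ i)\<^sup>2"
        \<comment> \<open>The two sides differ by exactly this square.\<close>
        using zero_le_power2[of "v $ i - 2 * u $ i"] by (simp add: power2_eq_square algebra_simps)
    qed
    also have "\<dots> = 2 * (\<Sum>i\<in>S - T. ?e i) + 2 * (\<Sum>i\<in>S - T. (u $ i)\<^sup>2)"
      by (simp add: sum.distrib sum_distrib_left)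
    also have "(\<Sum>i\<in>S - T. (u $ i)\<^sup>2) \<le> (\<Sum>i\<in>T - S. (u $ i)\<^sup>2)"
      by (rule sum_squares_exchange[OF card top])
    also have "(\<Sum>i\<in>T - S. (u $ i)\<^sup>2) = (\<Sum>i\<in>T - S. ?e i)"
      using v by (intro sum.cong) auto
    also have "\<dots> \<le> (\<Sum>i\<in>T. ?e i)" by (intro sum_mono2) auto
    finally have "(\<Sum>i\<in>S - T. (v $ i)\<^sup>2) \<le> 2 * (\<Sum>i\<in>S - T. ?e i) + 2 * (\<Sum>i\<in>T. ?e i)" by simp
    moreover have "(\<Sum>i\<in>S \<union> T. ?e i) = (\<Sum>i\<in>S - T. ?e i) + (\<Sum>i\<in>T. ?e i)"
    proof -
      have "S \<union> T = (S - T) \<union> T" by blast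
      then show ?thesis
        by (metis (no_types, lifting) Diff_disjoint Int_commute finite sum.union_disjoint)
    qed
    moreover have "0 \<le> (\<Sum>i\<in>S - T. ?e i)" by (intro sum_nonneg) auto
    ultimately show ?thesis by linarith
  qed
  also have "\<dots> \<le> 3 * (\<Sum>i\<in>V. ?e i)"
    using V by (intro mult_left_mono sum_mono2) auto
  also have "\<dots> = (sqrt 3 * norm (restrict_vec V (u - v)))\<^sup>2"
    by (simp add: power_mult_distrib norm_restrict_vec_squared)
  finally show ?thesis by (rule power2_le_imp_le) simp
qed

lemma hard_thresholds_sparse:
  fixes u :: "real ^ 'a"
  assumes "z \<in> hard_thresholds k u"
  shows "q_sparse k z"
proof -
  obtain T where "card T = min k CARD('a)" "z = restrict_vec T u"
    using assms by (auto simp: hard_thresholds_def restrict_vec_def)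
  then show ?thesis by (intro q_sparse_supported[of T]) (auto simp: restrict_vec_component)
qed

section \<open>Convergence of the iteration\<close>

lemma nsiht_contraction:
  fixes A :: "real ^ 'n ^ 'm"
  assumes rip: "rip A (3 * k) \<delta>" and d: "0 \<le> \<delta>"
    and eps: "0 < \<epsilon>" "(sigma_max A)\<^sup>2 \<le> \<epsilon>"
    and lam: "0 \<le> lam" "lam \<le> \<epsilon> + (sigma_min A)\<^sup>2"
    and y: "y = A *v x + e" and xS: "xS \<in> hard_thresholds k x"
    and z: "q_sparse k z" and z': "z' \<in> hard_thresholds k (nsiht_step A y \<epsilon> lam z)"
  defines "M \<equiv> (sigma_max A)\<^sup>2"
  shows "norm (z' - xS) \<le> sqrt 3 * (\<delta> + M - lam * M / (\<epsilon> + M)) * norm (z - xS) +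
    sqrt 3 * lam * sigma_max A / (\<epsilon> + M) * norm (A *v (x - xS) + e)"
proof -
  define u where "u = nsiht_step A y \<epsilon> lam z"
  define r where "r = A *v (x - xS) + e"
  define w where "w = z - xS"
  define N where "N = matrix_inv (transpose A ** A + \<epsilon> *\<^sub>R mat 1)"
  define d1 where "d1 = N *v (transpose A *v (A *v w))"
  define h where "h = N *v (transpose A *v r)"
  let ?B = "\<lambda>v. transpose A *v (A *v v)"
  obtain S where S: "card S = min k CARD('n)" "xS = restrict_vec S x"
    using xS by (auto simp: hard_thresholds_def restrict_vec_def)
  obtain T where T: "card T = min k CARD('n)" "\<forall>i\<in>T. \<forall>j. j \<notin> T \<longrightarrow> \<bar>u $ j\<bar> \<le> \<bar>u $ i\<bar>"
      "z' = restrict_vec T u"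
    using z' by (auto simp: hard_thresholds_def restrict_vec_def u_def)
  \<comment> \<open>The order \<open>3 * k\<close> comes from these three sets: the support of the
    current iterate, that of the target, and the newly selected indices.\<close>
  define V where "V = {i. z $ i \<noteq> 0} \<union> (S \<union> T)"
  have xS0: "xS $ i = 0" if "i \<notin> S" for i using that by (simp add: S(2) restrict_vec_component)
  have "card V \<le> card {i. z $ i \<noteq> 0} + (card S + card T)"
    unfolding V_def by (meson add_left_mono card_Un_le order_trans)
  then have cV: "card V \<le> 3 * k" using z S(1) T(1) by (simp add: q_sparse_def)
  have wV: "w $ i = 0" if "i \<notin> V" for i
    using that xS0 by (auto simp: w_def V_def)
  have "y - A *v z = r - A *v w"
    by (simp add: y r_def w_def matrix_vector_mult_diff_distrib)
  then have "N *v (transpose A *v (y - A *v z)) = h - d1"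
    by (simp add: h_def d1_def matrix_vector_mult_diff_distrib del: transpose_matrix_vector)
  then have "u - xS = (w - ?B w) + (?B w - lam *\<^sub>R d1) + lam *\<^sub>R h"
    by (simp add: u_def nsiht_step_def N_def[symmetric] w_def scaleR_diff_right
        del: transpose_matrix_vector)
  then have "norm (restrict_vec V (u - xS)) \<le> norm (restrict_vec V (w - ?B w)) +
      norm (restrict_vec V (?B w - lam *\<^sub>R d1)) + norm (restrict_vec V (lam *\<^sub>R h))"
    by (simp only: restrict_vec_add) (intro order_trans[OF norm_triangle_ineq] add_right_mono norm_triangle_ineq)
  \<comment> \<open>Only the isometry part keeps its restriction; the spectral bounds for the other
    two hold on the whole space.\<close>
  also have "\<dots> \<le> norm (restrict_vec V (w - ?B w)) + norm (?B w - lam *\<^sub>R d1) + norm (lam *\<^sub>R h)"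
    by (intro add_mono norm_restrict_vec_le order_refl)
  also have "norm (restrict_vec V (w - ?B w)) \<le> \<delta> * norm w"
    using rip cV wV d by (rule rip_restrict_bound)
  also have "norm (?B w - lam *\<^sub>R d1) \<le> (M - lam * M / (\<epsilon> + M)) * norm w"
    unfolding M_def using eps(1) lam(2)
    by (rule regularised_residual_bound) (simp only: d1_def N_def regularised_gram_inverse[OF eps(1)])
  also have "norm (lam *\<^sub>R h) \<le> lam * (sigma_max A / (\<epsilon> + M) * norm r)"
  proof -
    have "norm h \<le> sigma_max A / (\<epsilon> + M) * norm r"
      unfolding M_def using eps
      by (rule regularised_pseudoinverse_bound)
        (simp only: h_def N_def regularised_gram_inverse[OF eps(1)])
    from mult_left_mono[OF this lam(1)] show ?thesis using lam(1) by simp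
  qed
  finally have *: "norm (restrict_vec V (u - xS)) \<le>
      \<delta> * norm w + (M - lam * M / (\<epsilon> + M)) * norm w + lam * (sigma_max A / (\<epsilon> + M) * norm r)"
    by simp
  have "norm (z' - xS) \<le> sqrt 3 * norm (restrict_vec V (u - xS))"
    unfolding T(3) using S(1) T(1,2) xS0 by (intro hard_threshold_error) (auto simp: V_def)
  also have "\<dots> \<le> sqrt 3 * (\<delta> * norm w + (M - lam * M / (\<epsilon> + M)) * norm w +
      lam * (sigma_max A / (\<epsilon> + M) * norm r))"
    using * by (intro mult_left_mono) auto
  also have "\<dots> = sqrt 3 * (\<delta> + M - lam * M / (\<epsilon> + M)) * norm w +
      sqrt 3 * lam * sigma_max A / (\<epsilon> + M) * norm r"
    by (simp add: algebra_simps)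
  finally show ?thesis unfolding w_def r_def .
qed

text \<open>\<open>c / (1 - \<rho>)\<close> is the fixed point of t -> \<rho> t + c, so the
  induction step reproduces it exactly.\<close>

lemma affine_recursion_bound:
  fixes a :: "nat \<Rightarrow> real"
  assumes step: "\<And>p. a (Suc p) \<le> \<rho> * a p + c" and rho: "0 \<le> \<rho>" "\<rho> < 1" and c: "0 \<le> c"
  shows "a p \<le> \<rho> ^ p * a 0 + c / (1 - \<rho>)"
proof (induction p)
  case 0
  then show ?case using rho c by simp
next
  case (Suc p)
  have "a (Suc p) \<le> \<rho> * (\<rho> ^ p * a 0 + c / (1 - \<rho>)) + c"
    using step[of p] mult_left_mono[OF Suc rho(1)] by linarith
  also have "\<dots> = \<rho> ^ Suc p * a 0 + c / (1 - \<rho>)"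
    using rho by (simp add: field_simps)
  finally show ?case .
qed

text \<open>Tested on a coordinate vector. It guarantees that the lower bound on the stepsize is
  nonnegative and that \<sigma>1 is nonzero.\<close>

lemma rip_lower_sigma_max:
  fixes A :: "real ^ 'n ^ 'm"
  assumes rip: "rip A q \<delta>" and q: "q \<ge> 1"
  shows "1 - \<delta> \<le> (sigma_max A)\<^sup>2"
proof -
  obtain i :: 'n where True by simp
  let ?z = "axis i 1 :: real ^ 'n"
  have "q_sparse q ?z" using q by (intro q_sparse_supported[of "{i}"]) (auto simp: axis_def)
  then have "(1 - \<delta>) * (norm ?z)\<^sup>2 \<le> (norm (A *v ?z))\<^sup>2" using rip by (auto simp: rip_def)
  also have "\<dots> \<le> (sigma_max A * norm ?z)\<^sup>2"
    using norm_matrix_vector_le_sigma_max[of A ?z] by (intro power_mono) auto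
  finally show ?thesis by simp
qed

text \<open>The start is taken \<open>k\<close>-sparse because the contraction is applied already at
  the first step, where the support of \<open>xs 0\<close> must fit into the \<open>3 * k\<close>
  indices. The second entry of the maximum below \<epsilon> says that the interval for
  \<open>lam\<close> is nonempty.\<close>

theorem mainTheorem2:
  fixes A :: "real ^ 'n ^ 'm"
    and x xS :: "real ^ 'n" and y e :: "real ^ 'm"
    and xs :: "nat \<Rightarrow> real ^ 'n"
    and k :: nat
    and \<delta> \<epsilon> lam \<rho> \<tau> \<sigma>1 \<sigma>m :: real
  assumes dims: "CARD('m) < CARD('n)"
    and k: "k \<ge> 1"
    and s1: "\<sigma>1 = sigma_max A"
    and sm: "\<sigma>m = sigma_min A"
    and ric: "is_ric A (3 * k) \<delta>"
    and ric_bound: "\<delta> < 1 / sqrt 3"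
    and measurements: "y = A *v x + e"
    and xS: "xS \<in> hard_thresholds k x"
    and eps: "\<epsilon> > max (\<sigma>1\<^sup>2) (((\<sigma>1\<^sup>2 - \<sigma>m\<^sup>2) / (1 / sqrt 3 - \<delta>) - 1) * \<sigma>1\<^sup>2)"
    and step_lower: "\<epsilon> + \<sigma>1\<^sup>2 - (1 / sqrt 3 - \<delta>) * ((\<epsilon> + \<sigma>1\<^sup>2) / \<sigma>1\<^sup>2) < lam"
    and step_upper: "lam \<le> \<epsilon> + \<sigma>m\<^sup>2"
    and init: "q_sparse k (xs 0)"
    and iterates: "nsiht_sequence A y k \<epsilon> lam xs"
    and rho: "\<rho> = sqrt 3 * (\<delta> + \<sigma>1\<^sup>2 - lam * \<sigma>1\<^sup>2 / (\<epsilon> + \<sigma>1\<^sup>2))"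
    and tau: "\<tau> = sqrt 3 * lam * \<sigma>1 / ((\<epsilon> + \<sigma>1\<^sup>2) * (1 - \<rho>))"
  shows "\<rho> < 1 \<and>
    (\<forall>p. norm (xs (Suc p) - xS) \<le> \<rho> ^ p * norm (xs 0 - xS) + \<tau> * norm (A *v (x - xS) + e))"
proof -
  define D where "D = 1 / sqrt 3 - \<delta>"
  have d: "0 < \<delta>" "rip A (3 * k) \<delta>" using ric by (auto simp: is_ric_def)
  have D: "0 < D" using ric_bound by (simp add: D_def)
  have sqrt3: "1 / sqrt 3 \<le> 1" by simp
  have M: "1 - \<delta> \<le> \<sigma>1\<^sup>2"
    unfolding s1 using d(2) k by (intro rip_lower_sigma_max[of A "3 * k"]) auto
  then have DM: "D \<le> \<sigma>1\<^sup>2" using sqrt3 unfolding D_def by linarith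
  then have Mpos: "0 < \<sigma>1\<^sup>2" using D by linarith
  have eps': "\<sigma>1\<^sup>2 < \<epsilon>" using eps by simp
  then have E: "0 < \<epsilon>" "0 < \<epsilon> + \<sigma>1\<^sup>2" using Mpos by linarith+
  have "D * (\<epsilon> + \<sigma>1\<^sup>2) \<le> \<sigma>1\<^sup>2 * (\<epsilon> + \<sigma>1\<^sup>2)" using DM E by (intro mult_right_mono) auto
  then have "D * ((\<epsilon> + \<sigma>1\<^sup>2) / \<sigma>1\<^sup>2) \<le> \<epsilon> + \<sigma>1\<^sup>2"
    using Mpos by (simp add: pos_divide_le_eq mult.commute)
  then have lam0: "0 < lam" using step_lower unfolding D_def by linarith
  \<comment> \<open>Rescaling the lower stepsize bound by this factor isolates the
    \<open>lam\<close> term of \<rho> and yields \<rho> < 1.\<close>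
  have "(\<epsilon> + \<sigma>1\<^sup>2 - D * ((\<epsilon> + \<sigma>1\<^sup>2) / \<sigma>1\<^sup>2)) * (\<sigma>1\<^sup>2 / (\<epsilon> + \<sigma>1\<^sup>2)) < lam * (\<sigma>1\<^sup>2 / (\<epsilon> + \<sigma>1\<^sup>2))"
    using step_lower Mpos E unfolding D_def by (intro mult_strict_right_mono) auto
  moreover have "(\<epsilon> + \<sigma>1\<^sup>2 - D * ((\<epsilon> + \<sigma>1\<^sup>2) / \<sigma>1\<^sup>2)) * (\<sigma>1\<^sup>2 / (\<epsilon> + \<sigma>1\<^sup>2)) = \<sigma>1\<^sup>2 - D"
  proof -
    have "(c - D * (c / M)) * (M / c) = M - D" if "M \<noteq> 0" "c \<noteq> 0" for c M :: real
      using that by (simp add: field_simps)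
    then show ?thesis using Mpos E by simp
  qed
  ultimately have "\<delta> + \<sigma>1\<^sup>2 - lam * \<sigma>1\<^sup>2 / (\<epsilon> + \<sigma>1\<^sup>2) < 1 / sqrt 3" unfolding D_def by simp
  then have rho1: "\<rho> < 1" unfolding rho by (simp add: pos_less_divide_eq mult.commute)
  have "\<sigma>m\<^sup>2 \<le> \<sigma>1\<^sup>2"
    unfolding s1 sm using sigma_min_nonneg sigma_min_le_sigma_max by (intro power_mono)
  \<comment> \<open>The upper stepsize bound is what keeps \<rho> nonnegative, as iterating the
    recursion requires.\<close>
  then have "lam * \<sigma>1\<^sup>2 \<le> (\<epsilon> + \<sigma>1\<^sup>2) * \<sigma>1\<^sup>2" using step_upper by (intro mult_right_mono) auto
  then have "lam * \<sigma>1\<^sup>2 / (\<epsilon> + \<sigma>1\<^sup>2) \<le> \<sigma>1\<^sup>2" using E by (simp add: pos_divide_le_eq mult.commute)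
  then have rho0: "0 \<le> \<rho>" unfolding rho using d(1) by simp
  define c where "c = sqrt 3 * lam * \<sigma>1 / (\<epsilon> + \<sigma>1\<^sup>2) * norm (A *v (x - xS) + e)"
  have c0: "0 \<le> c" unfolding c_def s1 using lam0 E sigma_max_nonneg[of A] by (simp add: s1)
  have sparse: "q_sparse k (xs p)" for p
    using init iterates hard_thresholds_sparse by (cases p) (auto simp: nsiht_sequence_def)
  have "norm (xs (Suc p) - xS) \<le> \<rho> * norm (xs p - xS) + c" for p
    unfolding rho c_def s1
    using d E(1) eps' lam0 step_upper measurements xS sparse[of p] iterates
    by (intro nsiht_contraction) (auto simp: s1 sm nsiht_sequence_def)
  then have bound: "norm (xs p - xS) \<le> \<rho> ^ p * norm (xs 0 - xS) + c / (1 - \<rho>)" for p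
    using rho0 rho1 c0 by (rule affine_recursion_bound)
  have "norm (xs (Suc p) - xS) \<le> \<rho> ^ p * norm (xs 0 - xS) + \<tau> * norm (A *v (x - xS) + e)" for p
  proof -
    \<comment> \<open>The recursion gives the exponent \<open>Suc p\<close> at iterate
      \<open>Suc p\<close>; the claim has \<open>p\<close>, which is weaker since 0 \<le> \<rho> <
      1.\<close>
    have "\<rho> ^ Suc p * norm (xs 0 - xS) \<le> \<rho> ^ p * norm (xs 0 - xS)"
      using rho0 rho1 by (intro mult_right_mono power_decreasing) auto
    moreover have "c / (1 - \<rho>) = \<tau> * norm (A *v (x - xS) + e)"
      by (simp add: c_def tau)
    ultimately show ?thesis using bound[of "Suc p"] by linarith
  qed
  then show ?thesis using rho1 by blast
qed

end
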